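(* Let $X$ be a set and let $Y$ be a nonempty subset of $X$. The semigroup $\overline{T}(X,Y)$ is semi-balanced if and only if $X$ is finite.
   Context: Maps are written on the right. $T(X)$ is the semigroup of all maps $X\to X$ under composition, and $\overline{T}(X,Y)=\{f\in T(X) : Yf\subseteq Y\}$. For $f\in T(X)$, the kernel $\ker(f)=\{(x,y)\in X\times X: xf=yf\}$ is an equivalence relation on $X$; a transversal of it is a subset of $X$ containing exactly one element of each class. The collapse $\mathrm{c}(f)$ is the cardinality of $X\setminus T_f$, where $T_f$ is any transversal of $\ker(f)$ (the cardinality does not depend on the choice), and the defect $\mathrm{d}(f)$ is the cardinality of $X\setminus Xf$. The map $f$ is semi-balanced if $\mathrm{c}(f)=\mathrm{d}(f)$ (as cardinals). A subsemigroup of $T(X)$ is semi-balanced if all its elements are semi-balanced. *)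

theory Defs
  imports Main "HOL-Library.FuncSet"
begin

unbundle cardinal_syntax

text \<open>
  A map from X to X is represented by a function that is undefined outside X, so that
  equality of maps is equality of functions. Maps are written on the right in the source:
  the product fg (first f, then g) is \<open>compose X g f\<close>.
\<close>

definition full_transf :: "'a set \<Rightarrow> ('a \<Rightarrow> 'a) set" where
  "full_transf X = X \<rightarrow>\<^sub>E X"

definition transf_subsemigroup :: "'a set \<Rightarrow> ('a \<Rightarrow> 'a) set \<Rightarrow> bool" where
  "transf_subsemigroup X S \<longleftrightarrow>
     S \<noteq> {} \<and> S \<subseteq> full_transf X \<and> (\<forall>f\<in>S. \<forall>g\<in>S. compose X g f \<in> S)"

definition Tbar :: "'a set \<Rightarrow> 'a set \<Rightarrow> ('a \<Rightarrow> 'a) set" where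
  "Tbar X Y = {f \<in> full_transf X. f ` Y \<subseteq> Y}"

definition map_ker :: "'a set \<Rightarrow> ('a \<Rightarrow> 'a) \<Rightarrow> 'a rel" where
  "map_ker X f = {(x, y) \<in> X \<times> X. f x = f y}"

definition transversal :: "'a set \<Rightarrow> 'a rel \<Rightarrow> 'a set \<Rightarrow> bool" where
  "transversal X r T \<longleftrightarrow> T \<subseteq> X \<and> (\<forall>C \<in> X // r. \<exists>!t. t \<in> T \<inter> C)"

text \<open>
  Cardinals are the well-orders \<open>|A|\<close> of the library; equality of cardinals is \<open>=o\<close>.
  A transversal exists, and the cardinal below does not depend on which one is chosen:
  see \<open>transversal_ker_exists\<close> and \<open>collapse_eq\<close>.
\<close>

definition collapse :: "'a set \<Rightarrow> ('a \<Rightarrow> 'a) \<Rightarrow> 'a rel" where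
  "collapse X f = |X - (SOME T. transversal X (map_ker X f) T)|"

definition defect :: "'a set \<Rightarrow> ('a \<Rightarrow> 'a) \<Rightarrow> 'a rel" where
  "defect X f = |X - f ` X|"

definition semi_balanced_map :: "'a set \<Rightarrow> ('a \<Rightarrow> 'a) \<Rightarrow> bool" where
  "semi_balanced_map X f \<longleftrightarrow> collapse X f =o defect X f"

definition semi_balanced :: "'a set \<Rightarrow> ('a \<Rightarrow> 'a) set \<Rightarrow> bool" where
  "semi_balanced X S \<longleftrightarrow> transf_subsemigroup X S \<and> (\<forall>f\<in>S. semi_balanced_map X f)"

lemma Tbar_subsemigroup:
  assumes "Y \<subseteq> X"
  shows "transf_subsemigroup X (Tbar X Y)"
proof -
  have "restrict id X \<in> Tbar X Y"
    using assms by (auto simp: Tbar_def full_transf_def)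
  moreover have "compose X g f \<in> Tbar X Y" if "f \<in> Tbar X Y" "g \<in> Tbar X Y" for f g
  proof -
    from that have X: "f \<in> X \<rightarrow>\<^sub>E X" "g \<in> X \<rightarrow>\<^sub>E X" and Y: "f ` Y \<subseteq> Y" "g ` Y \<subseteq> Y"
      by (simp_all add: Tbar_def full_transf_def)
    have "compose X g f \<in> X \<rightarrow>\<^sub>E X"
    proof -
      have "g (f x) \<in> X" if "x \<in> X" for x
        using PiE_mem[OF X(2) PiE_mem[OF X(1) that]] .
      then show ?thesis
        by (simp add: compose_def restrict_PiE_iff)
    qed
    moreover have "compose X g f y \<in> Y" if "y \<in> Y" for y
    proof -
      have "f y \<in> Y" using Y(1) that by blast
      then have "g (f y) \<in> Y" using Y(2) by blast
      with that assms show ?thesis by (simp add: compose_def subsetD)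
    qed
    ultimately show ?thesis
      by (simp add: Tbar_def full_transf_def image_subset_iff)
  qed
  ultimately show ?thesis
    unfolding transf_subsemigroup_def using Tbar_def by blast
qed

lemma equiv_map_ker: "equiv X (map_ker X f)"
  unfolding equiv_def refl_on_def sym_def trans_def map_ker_def by simp blast

lemma transversal_map_ker_iff:
  "transversal X (map_ker X f) T \<longleftrightarrow>
     T \<subseteq> X \<and> (\<forall>x\<in>X. \<exists>!t. t \<in> T \<and> f t = f x)"
proof -
  have "(\<exists>!t. t \<in> T \<inter> map_ker X f `` {x}) \<longleftrightarrow> (\<exists>!t. t \<in> T \<and> f t = f x)"
    if "T \<subseteq> X" "x \<in> X" for x
    by (intro arg_cong[where f = Ex1] ext) (use that in \<open>auto simp: map_ker_def\<close>)
  then show ?thesis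
    unfolding transversal_def quotient_def by (simp cong: conj_cong)
qed

lemma transversal_ker_exists: "\<exists>T. transversal X (map_ker X f) T"
proof
  have *: "inv_into X f (f x) \<in> X" "f (inv_into X f (f x)) = f x" if "x \<in> X" for x
    using that by (auto intro: inv_into_into f_inv_into_f)
  show "transversal X (map_ker X f) (inv_into X f ` f ` X)"
    unfolding transversal_map_ker_iff
  proof (intro conjI ballI)
    show "inv_into X f ` f ` X \<subseteq> X"
      using *(1) by blast
    show "\<exists>!t. t \<in> inv_into X f ` f ` X \<and> f t = f x" if "x \<in> X" for x
    proof (rule ex1I)
      show "inv_into X f (f x) \<in> inv_into X f ` f ` X \<and> f (inv_into X f (f x)) = f x"
        using *(2)[OF that] that by blast
      fix t assume "t \<in> inv_into X f ` f ` X \<and> f t = f x"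
      then obtain z where "z \<in> X" "t = inv_into X f (f z)" "f t = f x"
        by blast
      then show "t = inv_into X f (f x)"
        using *(2) by simp
    qed
  qed
qed

lemma transversal_compl_ordLeq:
  assumes T: "transversal X (map_ker X f) T" and T': "transversal X (map_ker X f) T'"
  shows "|X - T| \<le>o |X - T'|"
proof -
  define r where "r x = (THE t. t \<in> T \<and> f t = f x)" for x
  have r: "r x \<in> T \<and> f (r x) = f x" if "x \<in> X" for x
    using T that theI'[of "\<lambda>t. t \<in> T \<and> f t = f x"]
    by (auto simp: r_def transversal_map_ker_iff)
  have sub: "T \<subseteq> X" "T' \<subseteq> X"
    using T T' by (auto simp: transversal_map_ker_iff)
  have uniq: "s = t" if "s \<in> T'" "t \<in> T'" "f s = f t" for s t
    using T' that sub unfolding transversal_map_ker_iff by (metis subsetD)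
  define h where "h x = (if x \<in> T' then r x else x)" for x
  have "inj_on h (X - T)"
  proof (rule inj_onI)
    fix x y assume xy: "x \<in> X - T" "y \<in> X - T" "h x = h y"
    then have "x \<in> T' \<longleftrightarrow> y \<in> T'"
      using r[of x] r[of y] by (auto simp: h_def split: if_splits)
    then show "x = y"
      using xy r[of x] r[of y] uniq[of x y] by (auto simp: h_def split: if_splits)
  qed
  moreover have "h ` (X - T) \<subseteq> X - T'"
  proof
    fix y assume "y \<in> h ` (X - T)"
    then obtain x where x: "x \<in> X" "x \<notin> T" "y = h x"
      by blast
    show "y \<in> X - T'"
      using x r[OF x(1)] uniq[of "r x" x] sub by (cases "x \<in> T'") (auto simp: h_def)
  qed
  ultimately show ?thesis
    using card_of_ordLeq by blast
qed

lemma collapse_eq: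
  assumes "transversal X (map_ker X f) T"
  shows "collapse X f =o |X - T|"
proof -
  have "transversal X (map_ker X f) (SOME T. transversal X (map_ker X f) T)"
    using transversal_ker_exists by (rule someI_ex)
  with assms show ?thesis
    unfolding collapse_def ordIso_iff_ordLeq by (simp add: transversal_compl_ordLeq)
qed

end

theory Submission
  imports Defs
begin

text \<open>
  If \<open>T\<close> is a transversal of \<open>ker f\<close>, then \<open>f\<close> maps \<open>T\<close> bijectively onto its image, so over a
  finite set the complements of \<open>T\<close> and of the image have the same size. If \<open>X\<close> is infinite,
  then so is \<open>Y\<close> or its complement \<open>X - Y\<close>; an injection of that part onto the part without one
  point, extended by the identity, preserves \<open>Y\<close> and has collapse 0 and defect 1.
\<close>

lemma transversal_bij_betw_image:
  assumes "transversal X (map_ker X f) T"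
  shows "bij_betw f T (f ` X)"
proof -
  have T: "T \<subseteq> X" "\<And>x. x \<in> X \<Longrightarrow> \<exists>!t. t \<in> T \<and> f t = f x"
    using assms by (auto simp: transversal_map_ker_iff)
  have "inj_on f T"
  proof (rule inj_onI)
    fix x y assume "x \<in> T" "y \<in> T" "f x = f y"
    with T(1) T(2)[of y] show "x = y" by blast
  qed
  moreover have "f x \<in> f ` T" if "x \<in> X" for x
    using T(2)[OF that] by (metis imageI)
  with T(1) have "f ` T = f ` X"
    by blast
  ultimately show ?thesis
    by (simp add: bij_betw_def)
qed

lemma finite_semi_balanced_map:
  assumes "finite X" and "f ` X \<subseteq> X"
  shows "semi_balanced_map X f"
proof -
  obtain T where T: "transversal X (map_ker X f) T"
    using transversal_ker_exists by blast
  then have "T \<subseteq> X"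
    by (simp add: transversal_def)
  moreover have "card T = card (f ` X)"
    using bij_betw_same_card[OF transversal_bij_betw_image[OF T]] .
  \<comment> \<open>Finiteness enters here: \<open>T\<close> and the image have equal size, and
    subtracting from \<open>card X\<close> gives complements of equal size. For infinite
    \<open>X\<close> this cancellation fails.\<close>
  ultimately have "card (X - T) = card (X - f ` X)"
    using assms by (simp add: card_Diff_subset finite_subset)
  then have "|X - T| =o |X - f ` X|"
    using assms(1) by (metis card_of_ordIso finite_Diff finite_same_card_bij)
  with collapse_eq[OF T] show ?thesis
    unfolding semi_balanced_map_def defect_def by (rule ordIso_transitive)
qed

text \<open>Injectivity makes the kernel trivial, so \<open>X\<close> itself is a transversal and
  the collapse is zero; the defect must then vanish too. Hence one injective, non-surjective member
  refutes semi-balance.\<close>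

lemma semi_balanced_inj_imp_surj:
  assumes "semi_balanced_map X f" and "inj_on f X" and "f ` X \<subseteq> X"
  shows "f ` X = X"
proof -
  have "transversal X (map_ker X f) X"
    using assms(2) unfolding transversal_map_ker_iff inj_on_def by blast
  then have "collapse X f =o |{} :: 'a set|"
    using collapse_eq[of X f X] by simp
  then have "|X - f ` X| =o |{} :: 'a set|"
    using assms(1) unfolding semi_balanced_map_def defect_def
    by (meson ordIso_symmetric ordIso_transitive)
  then show ?thesis
    using assms(3) card_of_empty2 by blast
qed

lemma infinite_inj_not_surj_invariant:
  fixes X Y :: "'a set"
  assumes "infinite X" and "Y \<subseteq> X"
  obtains f where "f \<in> Tbar X Y" "inj_on f X" "f ` X \<noteq> X"
proof -
  \<comment> \<open>Either choice of \<open>A\<close> serves: the map \<open>f\<close> below leaves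
    both \<open>A\<close> and its complement in \<open>X\<close> invariant, and \<open>Y\<close> is
    one of these two sets.\<close>
  obtain A where A: "A = Y \<or> A = X - Y" "infinite A"
    using assms by (metis finite_Diff2)
  then obtain a h where a: "a \<in> A" and h: "bij_betw h A (A - {a})"
    using infinite_imp_nonempty[of A] infinite_imp_bij_betw[of A] by blast
  define f where "f = (\<lambda>x\<in>X. if x \<in> A then h x else x)"
  have AX: "A \<subseteq> X"
    using A(1) assms(2) by blast
  have f_in: "f x = h x" "f x \<in> A - {a}" if "x \<in> A" for x
    using h that AX by (auto simp: f_def bij_betw_def)
  have f_out: "f x = x" if "x \<in> X - A" for x
    using that by (simp add: f_def)
  show thesis
  proof
    have "f x \<in> X" if "x \<in> X" for x
      using f_in[of x] f_out[of x] that AX by (cases "x \<in> A") auto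
    moreover have "f y \<in> Y" if "y \<in> Y" for y
      using A(1) f_in(2)[of y] f_out[of y] that assms(2) by auto
    moreover have "f \<in> extensional X"
      by (simp add: f_def)
    ultimately show "f \<in> Tbar X Y"
      by (auto simp: Tbar_def full_transf_def PiE_def)
    show "inj_on f X"
    proof (rule inj_onI)
      fix x y assume xy: "x \<in> X" "y \<in> X" "f x = f y"
      \<comment> \<open>Points of \<open>A\<close> stay in \<open>A\<close> and all others in
        \<open>X\<close> are fixed, so equal values come from the same side.\<close>
      then have "x \<in> A \<longleftrightarrow> y \<in> A"
        using f_in(2) f_out by (metis DiffD1 DiffI)
      then show "x = y"
        using xy f_in(1) f_out bij_betw_imp_inj_on[OF h] by (metis DiffI inj_onD)
    qed
    \<comment> \<open>The value \<open>a\<close> is omitted by \<open>h\<close>, and a fixed point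
      outside \<open>A\<close> cannot equal \<open>a\<close>, which lies in
      \<open>A\<close>.\<close>
    have "a \<noteq> f x" if "x \<in> X" for x
      using f_in(2) f_out that a by (metis DiffD2 DiffI insertI1)
    then have "a \<notin> f ` X"
      by blast
    then show "f ` X \<noteq> X"
      using a AX by blast
  qed
qed

theorem theorem5p6:
  fixes X Y :: "'a set"
  assumes "Y \<subseteq> X" and "Y \<noteq> {}"
  shows "semi_balanced X (Tbar X Y) \<longleftrightarrow> finite X"
proof -
  have img: "f ` X \<subseteq> X" if "f \<in> Tbar X Y" for f
    using that by (auto simp: Tbar_def full_transf_def)
  show ?thesis
  proof
    assume sb: "semi_balanced X (Tbar X Y)"
    show "finite X"
    proof (rule ccontr)
      assume "infinite X"
      then obtain f where f: "f \<in> Tbar X Y" "inj_on f X" "f ` X \<noteq> X"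
        using infinite_inj_not_surj_invariant[OF _ assms(1)] by blast
      then show False
        using sb semi_balanced_inj_imp_surj[of X f] img[of f]
        by (simp add: semi_balanced_def)
    qed
  next
    assume "finite X"
    then show "semi_balanced X (Tbar X Y)"
      using Tbar_subsemigroup[OF assms(1)] finite_semi_balanced_map img
      unfolding semi_balanced_def by blast
  qed
qed

end
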